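(* Let $R$ be a Dedekind domain. Then for any two nonzero ideals $I \subsetneq J$ in $R$, $I^n \subsetneq J^n$ for all $n\geq 1$. *)

theory Defs
  imports "HOL-Algebra.Ring_Divisibility" "HOL-Algebra.Ideal_Product" "HOL-Algebra.Polynomials"
begin

section \<open>The field of fractions\<close>

text \<open>The fraction a/b is the class of all pairs (c, d), d nonzero, with ad = cb.\<close>

definition fraction :: "('a, 'b) ring_scheme \<Rightarrow> 'a \<Rightarrow> 'a \<Rightarrow> ('a \<times> 'a) set" where
  "fraction R a b =
     {(c, d). c \<in> carrier R \<and> d \<in> carrier R - {\<zero>\<^bsub>R\<^esub>} \<and> a \<otimes>\<^bsub>R\<^esub> d = c \<otimes>\<^bsub>R\<^esub> b}"

text \<open>The operations are given as unions over all representatives; that these unions collapse to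
  a single class is shown in \<open>fraction_field_mult\<close> and \<open>fraction_field_add\<close>.\<close>

definition fraction_field :: "('a, 'b) ring_scheme \<Rightarrow> ('a \<times> 'a) set ring" where
  "fraction_field R =
     \<lparr> carrier = {fraction R a b | a b. a \<in> carrier R \<and> b \<in> carrier R - {\<zero>\<^bsub>R\<^esub>}},
       monoid.mult = (\<lambda>S T. \<Union>(a, b)\<in>S. \<Union>(c, d)\<in>T. fraction R (a \<otimes>\<^bsub>R\<^esub> c) (b \<otimes>\<^bsub>R\<^esub> d)),
       one = fraction R \<one>\<^bsub>R\<^esub> \<one>\<^bsub>R\<^esub>,
       zero = fraction R \<zero>\<^bsub>R\<^esub> \<one>\<^bsub>R\<^esub>,
       add = (\<lambda>S T. \<Union>(a, b)\<in>S. \<Union>(c, d)\<in>T.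
                fraction R (a \<otimes>\<^bsub>R\<^esub> d \<oplus>\<^bsub>R\<^esub> c \<otimes>\<^bsub>R\<^esub> b) (b \<otimes>\<^bsub>R\<^esub> d)) \<rparr>"

definition fraction_embed :: "('a, 'b) ring_scheme \<Rightarrow> 'a \<Rightarrow> ('a \<times> 'a) set" where
  "fraction_embed R a = fraction R a \<one>\<^bsub>R\<^esub>"

context "domain"
begin

lemma fraction_eq_iff:
  assumes "a \<in> carrier R" "b \<in> carrier R - {\<zero>}" "c \<in> carrier R" "d \<in> carrier R - {\<zero>}"
  shows "fraction R a b = fraction R c d \<longleftrightarrow> a \<otimes> d = c \<otimes> b"
proof
  assume "fraction R a b = fraction R c d"
  moreover have "(c, d) \<in> fraction R c d"
    using assms by (simp add: fraction_def)
  ultimately have "(c, d) \<in> fraction R a b" by simp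
  then show "a \<otimes> d = c \<otimes> b" by (simp add: fraction_def)
next
  have sub: "fraction R a b \<subseteq> fraction R c d"
    if in_R: "a \<in> carrier R" "b \<in> carrier R - {\<zero>}" "c \<in> carrier R" "d \<in> carrier R - {\<zero>}"
      and eq: "a \<otimes> d = c \<otimes> b" for a b c d
  proof
    fix p assume "p \<in> fraction R a b"
    then obtain x y where p: "p = (x, y)" "x \<in> carrier R" "y \<in> carrier R - {\<zero>}" "a \<otimes> y = x \<otimes> b"
      by (auto simp: fraction_def)
    have "b \<otimes> (c \<otimes> y) = (c \<otimes> b) \<otimes> y" using in_R p by (simp add: m_ac)
    also have "\<dots> = (a \<otimes> d) \<otimes> y" by (simp only: eq)
    also have "\<dots> = (a \<otimes> y) \<otimes> d" using in_R p(2,3) by (simp add: m_ac)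
    also have "\<dots> = (x \<otimes> b) \<otimes> d" by (simp only: p(4))
    also have "\<dots> = b \<otimes> (x \<otimes> d)" using in_R p(2,3) by (simp add: m_ac)
    finally have "c \<otimes> y = x \<otimes> d" using in_R p m_lcancel by auto
    then show "p \<in> fraction R c d" using p by (simp add: fraction_def)
  qed
  assume "a \<otimes> d = c \<otimes> b"
  then show "fraction R a b = fraction R c d"
    using sub[of a b c d] sub[of c d a b] assms by auto
qed

lemma fraction_memD:
  assumes "(x, y) \<in> fraction R a b" "a \<in> carrier R" "b \<in> carrier R - {\<zero>}"
  shows "x \<in> carrier R" "y \<in> carrier R - {\<zero>}" "a \<otimes> y = x \<otimes> b"
  using assms by (auto simp: fraction_def)

lemma fraction_self_mem:
  assumes "a \<in> carrier R" "b \<in> carrier R - {\<zero>}"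
  shows "(a, b) \<in> fraction R a b"
  using assms by (simp add: fraction_def)

lemma nonzero_mult_closed:
  assumes "b \<in> carrier R - {\<zero>}" "d \<in> carrier R - {\<zero>}"
  shows "b \<otimes> d \<in> carrier R - {\<zero>}"
  using assms integral by blast

lemma fraction_field_mult:
  assumes "a \<in> carrier R" "b \<in> carrier R - {\<zero>}" "c \<in> carrier R" "d \<in> carrier R - {\<zero>}"
  shows "fraction R a b \<otimes>\<^bsub>fraction_field R\<^esub> fraction R c d = fraction R (a \<otimes> c) (b \<otimes> d)"
proof -
  have *: "fraction R (x \<otimes> z) (y \<otimes> w) = fraction R (a \<otimes> c) (b \<otimes> d)"
    if "(x, y) \<in> fraction R a b" "(z, w) \<in> fraction R c d" for x y z w
  proof -
    note xy = fraction_memD[OF that(1) assms(1,2)]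
    note zw = fraction_memD[OF that(2) assms(3,4)]
    have "(x \<otimes> z) \<otimes> (b \<otimes> d) = (x \<otimes> b) \<otimes> (z \<otimes> d)" using assms xy(1,2) zw(1,2) by (simp add: m_ac)
    also have "\<dots> = (a \<otimes> y) \<otimes> (c \<otimes> w)" using xy zw by simp
    also have "\<dots> = (a \<otimes> c) \<otimes> (y \<otimes> w)" using assms xy(1,2) zw(1,2) by (simp add: m_ac)
    finally show ?thesis
      using assms xy zw nonzero_mult_closed by (subst fraction_eq_iff) auto
  qed
  have "fraction R a b \<otimes>\<^bsub>fraction_field R\<^esub> fraction R c d
      = (\<Union>(x, y)\<in>fraction R a b. \<Union>(z, w)\<in>fraction R c d. fraction R (a \<otimes> c) (b \<otimes> d))"
    unfolding fraction_field_def using * by (simp add: case_prod_beta)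
  then show ?thesis
    using fraction_self_mem[OF assms(1,2)] fraction_self_mem[OF assms(3,4)]
    by (simp add: case_prod_beta) blast
qed

lemma fraction_field_add:
  assumes "a \<in> carrier R" "b \<in> carrier R - {\<zero>}" "c \<in> carrier R" "d \<in> carrier R - {\<zero>}"
  shows "fraction R a b \<oplus>\<^bsub>fraction_field R\<^esub> fraction R c d
       = fraction R (a \<otimes> d \<oplus> c \<otimes> b) (b \<otimes> d)"
proof -
  have *: "fraction R (x \<otimes> w \<oplus> z \<otimes> y) (y \<otimes> w) = fraction R (a \<otimes> d \<oplus> c \<otimes> b) (b \<otimes> d)"
    if "(x, y) \<in> fraction R a b" "(z, w) \<in> fraction R c d" for x y z w
  proof -
    note xy = fraction_memD[OF that(1) assms(1,2)]
    note zw = fraction_memD[OF that(2) assms(3,4)]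
    have "(x \<otimes> w \<oplus> z \<otimes> y) \<otimes> (b \<otimes> d) = (x \<otimes> b) \<otimes> (w \<otimes> d) \<oplus> (z \<otimes> d) \<otimes> (y \<otimes> b)"
      using assms xy(1,2) zw(1,2) by (simp add: l_distr r_distr m_ac)
    also have "\<dots> = (a \<otimes> y) \<otimes> (w \<otimes> d) \<oplus> (c \<otimes> w) \<otimes> (y \<otimes> b)" using xy zw by simp
    also have "\<dots> = (a \<otimes> d \<oplus> c \<otimes> b) \<otimes> (y \<otimes> w)"
      using assms xy(1,2) zw(1,2) by (simp add: l_distr r_distr m_ac)
    finally show ?thesis
      using assms xy zw nonzero_mult_closed by (subst fraction_eq_iff) auto
  qed
  have "fraction R a b \<oplus>\<^bsub>fraction_field R\<^esub> fraction R c d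
      = (\<Union>(x, y)\<in>fraction R a b. \<Union>(z, w)\<in>fraction R c d.
           fraction R (a \<otimes> d \<oplus> c \<otimes> b) (b \<otimes> d))"
    unfolding fraction_field_def using * by (simp add: case_prod_beta)
  then show ?thesis
    using fraction_self_mem[OF assms(1,2)] fraction_self_mem[OF assms(3,4)]
    by (simp add: case_prod_beta) blast
qed

lemma fraction_in_carrier:
  assumes "a \<in> carrier R" "b \<in> carrier R - {\<zero>}"
  shows "fraction R a b \<in> carrier (fraction_field R)"
  using assms by (auto simp: fraction_field_def)

lemma fraction_field_carrierE:
  assumes "S \<in> carrier (fraction_field R)"
  obtains a b where "a \<in> carrier R" "b \<in> carrier R - {\<zero>}" "S = fraction R a b"
  using assms by (auto simp: fraction_field_def)

lemma fraction_field_one: "\<one>\<^bsub>fraction_field R\<^esub> = fraction R \<one> \<one>"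
  and fraction_field_zero: "\<zero>\<^bsub>fraction_field R\<^esub> = fraction R \<zero> \<one>"
  by (simp_all add: fraction_field_def)

lemma one_nonzero_mem: "\<one> \<in> carrier R - {\<zero>}"
  by simp

theorem fraction_field_is_field: "field (fraction_field R)"
proof -
  let ?K = "fraction_field R"
  note simps = fraction_field_mult fraction_field_add fraction_field_one fraction_field_zero
  note nz = nonzero_mult_closed one_nonzero_mem
  have "cring ?K"
  proof (rule cringI)
    show "abelian_group ?K"
    proof (rule abelian_groupI)
      show "\<zero>\<^bsub>?K\<^esub> \<in> carrier ?K"
        unfolding fraction_field_zero by (rule fraction_in_carrier) auto
    next
      fix S T assume "S \<in> carrier ?K" "T \<in> carrier ?K"
      then obtain a b c d where *: "a \<in> carrier R" "b \<in> carrier R - {\<zero>}" "S = fraction R a b"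
        "c \<in> carrier R" "d \<in> carrier R - {\<zero>}" "T = fraction R c d"
        by (metis fraction_field_carrierE)
      show "S \<oplus>\<^bsub>?K\<^esub> T \<in> carrier ?K"
        using * nz(1)[of b d] by (simp add: fraction_field_add fraction_in_carrier)
      have "a \<otimes> d \<oplus> c \<otimes> b = c \<otimes> b \<oplus> a \<otimes> d" "b \<otimes> d = d \<otimes> b"
        using * by (auto simp: a_comm m_comm)
      then show "S \<oplus>\<^bsub>?K\<^esub> T = T \<oplus>\<^bsub>?K\<^esub> S"
        using * by (simp add: fraction_field_add)
    next
      fix S T U assume "S \<in> carrier ?K" "T \<in> carrier ?K" "U \<in> carrier ?K"
      then obtain a b c d e f where *: "a \<in> carrier R" "b \<in> carrier R - {\<zero>}" "S = fraction R a b"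
        "c \<in> carrier R" "d \<in> carrier R - {\<zero>}" "T = fraction R c d"
        "e \<in> carrier R" "f \<in> carrier R - {\<zero>}" "U = fraction R e f"
        by (metis fraction_field_carrierE)
      have "(a \<otimes> d \<oplus> c \<otimes> b) \<otimes> f \<oplus> e \<otimes> (b \<otimes> d) = a \<otimes> (d \<otimes> f) \<oplus> (c \<otimes> f \<oplus> e \<otimes> d) \<otimes> b"
        "b \<otimes> d \<otimes> f = b \<otimes> (d \<otimes> f)"
        using * by (auto simp: l_distr r_distr m_ac a_ac)
      then show "S \<oplus>\<^bsub>?K\<^esub> T \<oplus>\<^bsub>?K\<^esub> U = S \<oplus>\<^bsub>?K\<^esub> (T \<oplus>\<^bsub>?K\<^esub> U)"
        using * nz(1)[of b d] nz(1)[of d f] by (simp add: fraction_field_add)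
    next
      fix S assume "S \<in> carrier ?K"
      then obtain a b where *: "a \<in> carrier R" "b \<in> carrier R - {\<zero>}" "S = fraction R a b"
        by (metis fraction_field_carrierE)
      show "\<zero>\<^bsub>?K\<^esub> \<oplus>\<^bsub>?K\<^esub> S = S"
        using * by (simp add: simps)
      have "fraction R (\<ominus> a) b \<oplus>\<^bsub>?K\<^esub> S = \<zero>\<^bsub>?K\<^esub>"
        using * nz(1)[of b b] by (simp add: simps l_minus l_neg fraction_eq_iff)
      then show "\<exists>T\<in>carrier ?K. T \<oplus>\<^bsub>?K\<^esub> S = \<zero>\<^bsub>?K\<^esub>"
        using * by (intro bexI[of _ "fraction R (\<ominus> a) b"] fraction_in_carrier) auto
    qed
  next
    show "comm_monoid ?K"
    proof (rule comm_monoidI)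
      show "\<one>\<^bsub>?K\<^esub> \<in> carrier ?K"
        unfolding fraction_field_one by (rule fraction_in_carrier) auto
    next
      fix S T assume "S \<in> carrier ?K" "T \<in> carrier ?K"
      then obtain a b c d where *: "a \<in> carrier R" "b \<in> carrier R - {\<zero>}" "S = fraction R a b"
        "c \<in> carrier R" "d \<in> carrier R - {\<zero>}" "T = fraction R c d"
        by (metis fraction_field_carrierE)
      show "S \<otimes>\<^bsub>?K\<^esub> T \<in> carrier ?K"
        using * nz(1)[of b d] by (simp add: fraction_field_mult fraction_in_carrier)
      have "a \<otimes> c = c \<otimes> a" "b \<otimes> d = d \<otimes> b"
        using * by (auto simp: m_comm)
      then show "S \<otimes>\<^bsub>?K\<^esub> T = T \<otimes>\<^bsub>?K\<^esub> S"
        using * by (simp add: fraction_field_mult)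
    next
      fix S T U assume "S \<in> carrier ?K" "T \<in> carrier ?K" "U \<in> carrier ?K"
      then obtain a b c d e f where *: "a \<in> carrier R" "b \<in> carrier R - {\<zero>}" "S = fraction R a b"
        "c \<in> carrier R" "d \<in> carrier R - {\<zero>}" "T = fraction R c d"
        "e \<in> carrier R" "f \<in> carrier R - {\<zero>}" "U = fraction R e f"
        by (metis fraction_field_carrierE)
      show "S \<otimes>\<^bsub>?K\<^esub> T \<otimes>\<^bsub>?K\<^esub> U = S \<otimes>\<^bsub>?K\<^esub> (T \<otimes>\<^bsub>?K\<^esub> U)"
        using * nz(1)[of b d] nz(1)[of d f] by (simp add: fraction_field_mult m_assoc)
    next
      fix S assume "S \<in> carrier ?K"
      then obtain a b where *: "a \<in> carrier R" "b \<in> carrier R - {\<zero>}" "S = fraction R a b"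
        by (metis fraction_field_carrierE)
      show "\<one>\<^bsub>?K\<^esub> \<otimes>\<^bsub>?K\<^esub> S = S"
        using * by (simp add: simps)
    qed
  next
    fix S T U assume "S \<in> carrier ?K" "T \<in> carrier ?K" "U \<in> carrier ?K"
    then obtain a b c d e f where *: "a \<in> carrier R" "b \<in> carrier R - {\<zero>}" "S = fraction R a b"
      "c \<in> carrier R" "d \<in> carrier R - {\<zero>}" "T = fraction R c d"
      "e \<in> carrier R" "f \<in> carrier R - {\<zero>}" "U = fraction R e f"
      by (metis fraction_field_carrierE)
    have "((a \<otimes> d \<oplus> c \<otimes> b) \<otimes> e) \<otimes> ((b \<otimes> f) \<otimes> (d \<otimes> f))
        = ((a \<otimes> e) \<otimes> (d \<otimes> f) \<oplus> (c \<otimes> e) \<otimes> (b \<otimes> f)) \<otimes> ((b \<otimes> d) \<otimes> f)"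
      using * by (simp add: l_distr r_distr m_ac)
    then show "(S \<oplus>\<^bsub>?K\<^esub> T) \<otimes>\<^bsub>?K\<^esub> U = S \<otimes>\<^bsub>?K\<^esub> U \<oplus>\<^bsub>?K\<^esub> T \<otimes>\<^bsub>?K\<^esub> U"
      using * nz(1)[of b d] nz(1)[of d f] nz(1)[of b f] nz(1)[of "b \<otimes> d" f]
        nz(1)[of "b \<otimes> f" "d \<otimes> f"]
      by (simp add: simps fraction_eq_iff)
  qed
  then interpret K: cring ?K .
  show ?thesis
  proof (rule K.cring_fieldI2)
    show "\<zero>\<^bsub>?K\<^esub> \<noteq> \<one>\<^bsub>?K\<^esub>"
      by (simp add: simps fraction_eq_iff)
  next
    fix S assume "S \<in> carrier ?K" "S \<noteq> \<zero>\<^bsub>?K\<^esub>"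
    then obtain a b where *: "a \<in> carrier R" "b \<in> carrier R - {\<zero>}" "S = fraction R a b"
      by (metis fraction_field_carrierE)
    with \<open>S \<noteq> \<zero>\<^bsub>?K\<^esub>\<close> have "a \<noteq> \<zero>"
      by (auto simp: simps fraction_eq_iff)
    then have "S \<otimes>\<^bsub>?K\<^esub> fraction R b a = \<one>\<^bsub>?K\<^esub>"
      using * nz(1)[of a b] nz(1)[of b a] by (simp add: simps fraction_eq_iff m_comm)
    then show "\<exists>T\<in>carrier ?K. S \<otimes>\<^bsub>?K\<^esub> T = \<one>\<^bsub>?K\<^esub>"
      using * \<open>a \<noteq> \<zero>\<close> by (intro bexI[of _ "fraction R b a"] fraction_in_carrier) auto
  qed
qed

lemma fraction_embed_hom: "fraction_embed R \<in> ring_hom R (fraction_field R)"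
  by (rule ring_hom_memI)
    (auto simp: fraction_embed_def fraction_field_mult fraction_field_add fraction_field_one
      fraction_in_carrier)

lemma fraction_embed_inj: "inj_on (fraction_embed R) (carrier R)"
  by (auto simp: inj_on_def fraction_embed_def fraction_eq_iff)

lemma fraction_eq_quotient:
  assumes "a \<in> carrier R" "b \<in> carrier R - {\<zero>}"
  shows "fraction R a b
       = fraction_embed R a \<otimes>\<^bsub>fraction_field R\<^esub> inv\<^bsub>fraction_field R\<^esub> (fraction_embed R b)"
proof -
  interpret K: field "fraction_field R" by (rule fraction_field_is_field)
  have "fraction_embed R b \<otimes>\<^bsub>fraction_field R\<^esub> fraction R \<one> b = \<one>\<^bsub>fraction_field R\<^esub>"
    using assms by (simp add: fraction_embed_def fraction_field_mult fraction_field_one fraction_eq_iff)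
  then have "inv\<^bsub>fraction_field R\<^esub> (fraction_embed R b) = fraction R \<one> b"
    using assms by (intro K.comm_inv_char) (auto simp: fraction_embed_def fraction_in_carrier)
  then show ?thesis
    using assms by (simp add: fraction_embed_def fraction_field_mult)
qed

end


section \<open>Integral elements and Dedekind domains\<close>

text \<open>Polynomials are coefficient lists with the leading coefficient first; the empty list is the
  zero polynomial, whose leading coefficient is unspecified and which is therefore excluded.\<close>

definition integral_over :: "('a, 'b) ring_scheme \<Rightarrow> 'a set \<Rightarrow> 'a \<Rightarrow> bool" where
  "integral_over K A x \<longleftrightarrow>
     (\<exists>p \<in> carrier (univ_poly K A). p \<noteq> [] \<and> lead_coeff p = \<one>\<^bsub>K\<^esub> \<and> ring.eval K p x = \<zero>\<^bsub>K\<^esub>)"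

definition integrally_closed :: "('a, 'b) ring_scheme \<Rightarrow> bool" where
  "integrally_closed R \<longleftrightarrow>
     (\<forall>x \<in> carrier (fraction_field R).
        integral_over (fraction_field R) (fraction_embed R ` carrier R) x \<longrightarrow>
        x \<in> fraction_embed R ` carrier R)"

text \<open>Fields are not excluded; for a statement about two distinct nonzero ideals this makes no
  difference.\<close>

locale dedekind_domain = noetherian_domain +
  assumes integrally_closed: "integrally_closed R"
    and nonzero_prime_maximal: "\<lbrakk> primeideal P R; P \<noteq> {\<zero>} \<rbrakk> \<Longrightarrow> maximalideal P R"

end

theory Submission
  imports Defs
begin

text \<open>Multiplication by a nonzero ideal of a Dedekind domain is cancellative, so
  \<open>I\<^sup>n = J\<^sup>n\<close> with \<open>I \<subseteq> J\<close> squeezes \<open>J\<^sup>n\<^sup>-\<^sup>1I\<close> onto \<open>J\<^sup>n\<^sup>-\<^sup>1J\<close> and forces \<open>I = J\<close>.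

  Cancellation is proved by Noetherian induction, without fractional ideals. If \<open>I\<close> is a
  proper nonzero ideal and \<open>0 \<noteq> a \<in> I\<close>, an associated-prime argument at a maximal ideal containing
  \<open>I\<close> yields \<open>b \<notin> (a)\<close> with \<open>bI \<subseteq> (a)\<close>. With \<open>B = ((a) : I)\<close> one has \<open>IB = aQ\<close> for an ideal
  \<open>Q \<supseteq> I\<close>. If \<open>Q\<close> were \<open>I\<close>, then \<open>bI \<subseteq> aI\<close>, so \<open>b/a\<close> would be integral over \<open>R\<close>
  and hence \<open>b \<in> (a)\<close>. So \<open>Q\<close> is strictly larger than \<open>I\<close>, and cancelling \<open>I\<close> reduces to cancelling
  \<open>a\<close> and \<open>Q\<close>.\<close>

section \<open>Products and colon ideals\<close>

lemma ideal_prod_mono: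
  assumes "I \<subseteq> I'" and "J \<subseteq> J'"
  shows "I \<cdot>\<^bsub>R\<^esub> J \<subseteq> I' \<cdot>\<^bsub>R\<^esub> J'"
proof
  fix s assume "s \<in> I \<cdot>\<^bsub>R\<^esub> J"
  then show "s \<in> I' \<cdot>\<^bsub>R\<^esub> J'"
    using assms by induct (auto intro: ideal_prod.intros)
qed

lemma (in ring) ideal_prod_least:
  assumes "ideal K R" and "\<And>i j. \<lbrakk> i \<in> I; j \<in> J \<rbrakk> \<Longrightarrow> i \<otimes> j \<in> K"
  shows "I \<cdot> J \<subseteq> K"
proof
  fix s assume "s \<in> I \<cdot> J"
  then show "s \<in> K"
    using assms by induct (auto intro: additive_subgroup.a_closed ideal.axioms(1))
qed

text \<open>The colon \<open>(I : M)\<close> is taken for an arbitrary subset \<open>M\<close> so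
  that it covers both annihilators modulo an ideal (\<open>M\<close> a singleton) and the colon of
  two ideals.\<close>

lemma (in cring) colon_ideal:
  assumes "ideal I R" and "M \<subseteq> carrier R"
  shows "ideal {y \<in> carrier R. \<forall>x\<in>M. y \<otimes> x \<in> I} R"
proof -
  interpret I: ideal I R by fact
  have M: "x \<in> carrier R" if "x \<in> M" for x
    using that assms(2) by blast
  show ?thesis
  proof (rule idealI)
    show "subgroup {y \<in> carrier R. \<forall>x\<in>M. y \<otimes> x \<in> I} (add_monoid R)"
      by (rule add.subgroupI) (auto simp: M l_distr l_minus simp flip: a_inv_def)
  next
    fix y r assume y: "y \<in> {y \<in> carrier R. \<forall>x\<in>M. y \<otimes> x \<in> I}" and r: "r \<in> carrier R"
    have "r \<otimes> y \<otimes> x \<in> I" if "x \<in> M" for x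
      using y r that I.I_l_closed[of "y \<otimes> x" r] by (simp add: M m_assoc)
    then show "r \<otimes> y \<in> {y \<in> carrier R. \<forall>x\<in>M. y \<otimes> x \<in> I}"
      using y r by simp
    then show "y \<otimes> r \<in> {y \<in> carrier R. \<forall>x\<in>M. y \<otimes> x \<in> I}"
      using y r by (simp add: m_comm)
  qed (rule ring_axioms)
qed

section \<open>Maximal members of families of ideals\<close>

lemma (in noetherian_ring) maximal_ideal_exists:
  assumes "S \<noteq> {}" and "S \<subseteq> {I. ideal I R}"
  obtains M where "M \<in> S" and "\<And>I. \<lbrakk> I \<in> S; M \<subseteq> I \<rbrakk> \<Longrightarrow> I = M"
proof -
  have "\<exists>M\<in>S. \<forall>I\<in>S. M \<subseteq> I \<longrightarrow> I = M"
  proof (rule subset_Zorn)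
    fix C assume C: "subset.chain S C"
    show "\<exists>U\<in>S. \<forall>I\<in>C. I \<subseteq> U"
    proof (cases "C = {}")
      case True
      then show ?thesis using assms(1) by blast
    next
      case False
      have "subset.chain {I. ideal I R} C"
        using C assms(2) unfolding pred_on.chain_def by blast
      \<comment> \<open>By the ascending chain condition a nonempty chain contains its own union, so
        the upper bound Zorn asks for lies in \<open>S\<close>.\<close>
      then have "\<Union>C \<in> C"
        by (rule ideal_chain_is_trivial[OF False])
      then show ?thesis
        using C unfolding pred_on.chain_def by (meson Union_upper subsetD)
    qed
  qed
  then show thesis using that by blast
qed

lemma (in noetherian_domain) exists_maximalideal_superset:
  assumes "ideal I R" and "I \<noteq> carrier R"
  obtains P where "maximalideal P R" and "I \<subseteq> P"
proof -
  let ?S = "{P. ideal P R \<and> P \<noteq> carrier R \<and> I \<subseteq> P}"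
  obtain P where P: "P \<in> ?S" and max: "\<And>Q. \<lbrakk> Q \<in> ?S; P \<subseteq> Q \<rbrakk> \<Longrightarrow> Q = P"
    using maximal_ideal_exists[of ?S] assms by blast
  have "maximalideal P R"
    using P max by (intro maximalidealI) blast+
  then show thesis using that P by blast
qed

section \<open>Associated primes and integral dependence\<close>

context dedekind_domain
begin

text \<open>Among the colon ideals \<open>(A : x)\<close> contained in \<open>P\<close> a maximal one is prime, hence equal to \<open>P\<close>.\<close>

lemma exists_annihilated_by_maximalideal:
  assumes P: "maximalideal P R" and A: "ideal A R" and "A \<subseteq> P" and "A \<noteq> {\<zero>}"
  obtains x where "x \<in> carrier R" and "x \<notin> A" and "\<And>y. y \<in> P \<Longrightarrow> y \<otimes> x \<in> A"
proof -
  define ann where "ann x = {y \<in> carrier R. \<forall>z\<in>{x}. y \<otimes> z \<in> A}" for x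
  interpret A: ideal A R by fact
  interpret P: primeideal P R using P by (rule maximalideal_prime)
  have ann_ideal: "ideal (ann x) R" if "x \<in> carrier R" for x
    unfolding ann_def using A that by (intro colon_ideal) auto
  have ann_iff: "y \<in> ann x \<longleftrightarrow> y \<in> carrier R \<and> y \<otimes> x \<in> A" for x y
    by (auto simp: ann_def)
  let ?S = "{ann x | x. x \<in> carrier R \<and> ann x \<subseteq> P}"
  \<comment> \<open>\<open>ann \<one>\<close> is \<open>A\<close> itself, which lies in
    \<open>P\<close>.\<close>
  have "ann \<one> \<in> ?S"
    using assms(3) A.Icarr by (intro CollectI exI[of _ \<one>]) (auto simp: ann_iff)
  then obtain M where M: "M \<in> ?S" and max: "\<And>N. \<lbrakk> N \<in> ?S; M \<subseteq> N \<rbrakk> \<Longrightarrow> N = M"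
    using maximal_ideal_exists[of ?S] ann_ideal by blast
  then obtain x where x: "x \<in> carrier R" "M = ann x" "ann x \<subseteq> P" by blast
  have mono: "ann x \<subseteq> ann (x \<otimes> z)" if "z \<in> carrier R" for z
    using that x(1) A.I_r_closed by (auto simp: ann_iff simp flip: m_assoc)
  have "primeideal (ann x) R"
  proof (rule primeidealI)
    show "carrier R \<noteq> ann x"
      using x(3) P.I_notcarr P.a_subset by blast
    fix y z assume yz: "y \<in> carrier R" "z \<in> carrier R" "y \<otimes> z \<in> ann x"
    show "y \<in> ann x \<or> z \<in> ann x"
    \<comment> \<open>If this ideal lies in \<open>P\<close>, maximality makes it
      \<open>ann x\<close>, and it contains \<open>y\<close>. Otherwise some \<open>s\<close>
      outside \<open>P\<close> lies in it; primality of \<open>P\<close> keeps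
      \<open>ann (x \<otimes> s)\<close> inside \<open>P\<close>, so that ideal is
      \<open>ann x\<close>, and it contains \<open>z\<close>.\<close>
    proof (cases "ann (x \<otimes> z) \<subseteq> P")
      case True
      then have "ann (x \<otimes> z) = ann x"
        using max[of "ann (x \<otimes> z)"] mono[of z] x yz by auto
      moreover have "y \<in> ann (x \<otimes> z)"
        using yz x(1) by (simp add: ann_iff m_ac)
      ultimately show ?thesis by simp
    next
      case False
      then obtain s where s: "s \<in> carrier R" "s \<otimes> (x \<otimes> z) \<in> A" "s \<notin> P"
        unfolding subset_iff ann_iff by blast
      have "ann (x \<otimes> s) \<subseteq> P"
      proof
        fix t assume t: "t \<in> ann (x \<otimes> s)"
        then have "t \<otimes> s \<in> ann x"
          using s x(1) by (auto simp: ann_iff m_ac)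
        then have "t \<otimes> s \<in> P" using x(3) by blast
        then show "t \<in> P"
          using P.I_prime[of t s] s t by (auto simp: ann_iff)
      qed
      then have "ann (x \<otimes> s) = ann x"
        using max[of "ann (x \<otimes> s)"] mono[of s] x s by auto
      moreover have "z \<in> ann (x \<otimes> s)"
        using s yz x(1) by (simp add: ann_iff m_ac)
      ultimately show ?thesis by simp
    qed
  qed (use ann_ideal x is_cring in auto)
  moreover have "ann x \<noteq> {\<zero>}"
  proof -
    have "A \<subseteq> ann x" using x(1) A.Icarr A.I_r_closed by (auto simp: ann_iff)
    then show ?thesis using assms(4) A.zero_closed by blast
  qed
  ultimately have "maximalideal (ann x) R"
    by (rule nonzero_prime_maximal)
  then have "ann x = P"
    using maximalideal.I_maximal[of "ann x" R P] x(3) P.I_notcarr P.ideal_axioms P.a_subset by blast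
  moreover have "x \<notin> A"
  proof
    assume "x \<in> A"
    then have "\<one> \<in> ann x" using x(1) by (simp add: ann_iff)
    with \<open>ann x = P\<close> show False using P.one_imp_carrier P.I_notcarr by blast
  qed
  ultimately show thesis using that x(1) by (auto simp: ann_iff)
qed

text \<open>Starting from \<open>0 \<noteq> c\<^sub>0 \<in> I\<close>, the elements \<open>c\<^sub>k = (b/a)\<^sup>kc\<^sub>0\<close> all lie in \<open>I\<close>, and the chain of
  ideals \<open>(c\<^sub>0, \<dots>, c\<^sub>k\<^sub>-\<^sub>1)\<close> becomes stationary; dividing the resulting relation by \<open>c\<^sub>0\<close> gives an
  equation of integral dependence for \<open>b/a\<close>.\<close>

lemma stable_ideal_imp_divides:
  assumes I: "ideal I R" "I \<noteq> {\<zero>}"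
    and a: "a \<in> carrier R" "a \<noteq> \<zero>" and b: "b \<in> carrier R"
    and stable: "\<And>x. x \<in> I \<Longrightarrow> \<exists>y\<in>I. b \<otimes> x = a \<otimes> y"
  shows "b \<in> PIdl a"
proof -
  interpret I: ideal I R by fact
  let ?K = "fraction_field R"
  let ?e = "fraction_embed R"
  interpret K: field ?K by (rule fraction_field_is_field)
  have e: "?e \<in> ring_hom R ?K" by (rule fraction_embed_hom)
  note e_closed = ring_hom_closed[OF e] and e_mult = ring_hom_mult[OF e] and e_add = ring_hom_add[OF e]
  interpret e: ring_hom_cring R ?K ?e
    using e by (intro ring_hom_cringI) (auto intro: is_cring K.is_cring)
  obtain c0 where c0: "c0 \<in> I" "c0 \<noteq> \<zero>"
    using I(2) I.zero_closed by blast
  \<comment> \<open>\<open>f\<close> is multiplication by \<open>b/a\<close> on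
    \<open>I\<close>.\<close>
  obtain f where f: "\<And>x. x \<in> I \<Longrightarrow> f x \<in> I" "\<And>x. x \<in> I \<Longrightarrow> b \<otimes> x = a \<otimes> f x"
    using stable by metis
  define c where "c k = (f ^^ k) c0" for k
  have c_mem: "c k \<in> I" for k
    by (induction k) (auto simp: c_def c0 f)
  have c_Suc: "a \<otimes> c (Suc k) = b \<otimes> c k" for k
    using f(2)[OF c_mem[of k]] by (simp add: c_def)
  define x where "x = fraction R b a"
  have x: "x \<in> carrier ?K"
    unfolding x_def using a b by (intro fraction_in_carrier) auto
  have ex: "?e (c k) = ?e c0 \<otimes>\<^bsub>?K\<^esub> x [^]\<^bsub>?K\<^esub> k" for k
  proof (induction k)
    case 0
    then show ?case using c0 I.Icarr e_closed by (simp add: c_def)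
  next
    case (Suc k)
    have "?e (c (Suc k)) = ?e (c k) \<otimes>\<^bsub>?K\<^esub> x"
      using c_Suc[of k] c_mem I.Icarr a b
      by (simp add: x_def fraction_embed_def fraction_field_mult fraction_eq_iff m_comm)
    then show ?case
      using Suc c0 I.Icarr e_closed x by (simp add: K.m_assoc)
  qed
  \<comment> \<open>\<open>A k\<close> is generated by the first \<open>k\<close> elements
    \<open>c i\<close>, so \<open>c k\<close> enters only at \<open>A (Suc k)\<close>.\<close>
  define A where "A = rec_nat {\<zero>} (\<lambda>k B. B <+> PIdl (c k))"
  have A_0: "A 0 = {\<zero>}" and A_Suc: "A (Suc k) = A k <+> PIdl (c k)" for k
    by (simp_all add: A_def)
  have A_ideal: "ideal (A k) R" for k
    by (induction k) (auto simp: A_0 A_Suc intro: zeroideal add_ideals cgenideal_ideal c_mem I.Icarr)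
  have A_mono: "A k \<subseteq> A (Suc k)" and c_A: "c k \<in> A (Suc k)" for k
  proof -
    interpret A: ideal "A k" R by (rule A_ideal)
    have c: "c k \<in> carrier R" using c_mem I.Icarr by blast
    interpret C: ideal "PIdl (c k)" R using c by (rule cgenideal_ideal)
    show "A k \<subseteq> A (Suc k)"
    proof
      fix r assume "r \<in> A k"
      then have "r \<oplus> \<zero> \<in> A k <+> PIdl (c k)"
        unfolding set_add_def' using C.zero_closed by blast
      then show "r \<in> A (Suc k)" using \<open>r \<in> A k\<close> A.Icarr by (simp add: A_Suc)
    qed
    have "\<zero> \<oplus> c k \<in> A k <+> PIdl (c k)"
      unfolding set_add_def' using A.zero_closed cgenideal_self[OF c] by blast
    then show "c k \<in> A (Suc k)" using c by (simp add: A_Suc)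
  qed
  \<comment> \<open>Coefficient lists of exact length \<open>k\<close>, leading zeros allowed, stand
    for polynomials of degree below \<open>k\<close>; the coefficient of the new top power goes in
    front.\<close>
  have poly: "\<exists>q. length q = k \<and> set q \<subseteq> ?e ` carrier R \<and> ?e r = ?e c0 \<otimes>\<^bsub>?K\<^esub> K.eval q x"
    if "r \<in> A k" for r k
    using that
  proof (induction k arbitrary: r)
    case 0
    then show ?case using c0 I.Icarr e_closed by (auto simp: A_0)
  next
    case (Suc k)
    then obtain r' s where r': "r' \<in> A k" and s: "s \<in> carrier R" and r: "r = r' \<oplus> s \<otimes> c k"
      by (auto simp: A_Suc set_add_def' cgenideal_def)
    obtain q where q: "length q = k" "set q \<subseteq> ?e ` carrier R" "?e r' = ?e c0 \<otimes>\<^bsub>?K\<^esub> K.eval q x"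
      using Suc.IH[OF r'] by blast
    have "K.eval q x \<in> carrier ?K"
      using q(2) e_closed x by (intro K.eval_in_carrier) auto
    then have "?e c0 \<otimes>\<^bsub>?K\<^esub> K.eval (?e s # q) x
        = ?e s \<otimes>\<^bsub>?K\<^esub> (?e c0 \<otimes>\<^bsub>?K\<^esub> x [^]\<^bsub>?K\<^esub> k) \<oplus>\<^bsub>?K\<^esub> ?e c0 \<otimes>\<^bsub>?K\<^esub> K.eval q x"
      using q(1) e_closed x s c0 I.Icarr by (simp add: K.r_distr K.m_ac)
    also have "\<dots> = ?e r"
      using r r' s c_mem c0 I.Icarr ideal.Icarr[OF A_ideal] q(3)
      by (simp add: K.a_comm K.m_closed \<open>K.eval q x \<in> carrier ?K\<close> e_closed flip: ex)
    finally show ?case using q s by (intro exI[of _ "?e s # q"]) auto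
  qed
  have "subset.chain {I. ideal I R} (range A)"
    unfolding pred_on.chain_def using A_ideal lift_Suc_mono_le[of A, OF A_mono] nat_le_linear by blast
  then have "\<Union>(range A) \<in> range A"
    by (rule ideal_chain_is_trivial[rotated]) simp
  then obtain m where "\<Union>(range A) = A m" by blast
  then have "c m \<in> A m" using c_A by blast
  \<comment> \<open>The sign is changed so that prepending the coefficient one to the list for
    \<open>\<ominus> c m\<close> gives a monic polynomial vanishing at \<open>x\<close>.\<close>
  then have "\<ominus> c m \<in> A m"
    using A_ideal by (meson additive_subgroup.a_inv_closed ideal.axioms(1))
  then obtain q where q: "length q = m" "set q \<subseteq> ?e ` carrier R"
      "?e (\<ominus> c m) = ?e c0 \<otimes>\<^bsub>?K\<^esub> K.eval q x"
    using poly by blast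
  have qx: "K.eval q x \<in> carrier ?K"
    using q(2) e_closed x by (intro K.eval_in_carrier) auto
  let ?p = "\<one>\<^bsub>?K\<^esub> # q"
  have "?e c0 \<otimes>\<^bsub>?K\<^esub> K.eval ?p x = ?e (c m) \<oplus>\<^bsub>?K\<^esub> ?e (\<ominus> c m)"
    using qx q x e_closed c0 I.Icarr by (simp add: K.r_distr ex)
  also have "\<dots> = \<zero>\<^bsub>?K\<^esub>"
    using c_mem I.Icarr by (simp add: K.r_neg e_closed)
  finally have "?e c0 \<otimes>\<^bsub>?K\<^esub> K.eval ?p x = \<zero>\<^bsub>?K\<^esub>" .
  moreover have "?e c0 \<noteq> \<zero>\<^bsub>?K\<^esub>"
    using c0 I.Icarr by (simp add: fraction_embed_def fraction_field_zero fraction_eq_iff)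
  moreover have "K.eval ?p x \<in> carrier ?K"
    using qx x by simp
  ultimately have "K.eval ?p x = \<zero>\<^bsub>?K\<^esub>"
    using K.integral[of "?e c0"] c0 I.Icarr e_closed by blast
  moreover have "?p \<in> carrier (univ_poly ?K (?e ` carrier R))"
    using q(2) by (auto simp: univ_poly_def polynomial_def intro!: image_eqI[of _ ?e \<one>])
  ultimately have "integral_over ?K (?e ` carrier R) x"
    unfolding integral_over_def by (intro bexI[of _ ?p]) auto
  then obtain r where "r \<in> carrier R" "x = ?e r"
    using integrally_closed x unfolding integrally_closed_def by blast
  then have "b = r \<otimes> a"
    using a b by (simp add: x_def fraction_embed_def fraction_eq_iff)
  then show ?thesis
    using \<open>r \<in> carrier R\<close> by (auto simp: cgenideal_def)
qed

section \<open>Cancellation of nonzero ideals\<close>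

lemma ideal_prod_principal_cancel:
  assumes a: "a \<in> carrier R" "a \<noteq> \<zero>" and L: "ideal L R" and N: "ideal N R"
    and sub: "(PIdl a) \<cdot> L \<subseteq> (PIdl a) \<cdot> N"
  shows "L \<subseteq> N"
proof
  interpret N: ideal N R by fact
  let ?aN = "{a \<otimes> y | y. y \<in> N}"
  \<comment> \<open>The factor \<open>a\<close> can be pulled out of a whole sum of products, so
    cancellation of ideals reduces to cancellation of elements.\<close>
  have *: "s \<in> ?aN" if "s \<in> (PIdl a) \<cdot> N" for s
    using that
  proof induct
    case (prod i j)
    then obtain r where "r \<in> carrier R" "i = r \<otimes> a" by (auto simp: cgenideal_def)
    then have "i \<otimes> j = a \<otimes> (r \<otimes> j)" "r \<otimes> j \<in> N"
      using prod a N.Icarr N.I_l_closed by (auto simp: m_ac)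
    then show ?case by blast
  next
    case (sum s1 s2)
    then obtain y z where "s1 = a \<otimes> y" "s2 = a \<otimes> z" "y \<in> N" "z \<in> N" by blast
    then have "s1 \<oplus> s2 = a \<otimes> (y \<oplus> z)" "y \<oplus> z \<in> N"
      using a N.Icarr by (auto simp: r_distr)
    then show ?case by blast
  qed
  fix x assume x: "x \<in> L"
  then have "a \<otimes> x \<in> (PIdl a) \<cdot> L"
    using cgenideal_self[OF a(1)] by (rule ideal_prod.prod[rotated])
  then obtain y where "a \<otimes> x = a \<otimes> y" "y \<in> N"
    using sub * by blast
  then show "x \<in> N"
    using a x m_lcancel[of a x y] N.Icarr ideal.Icarr[OF L x] by auto
qed

lemma ideal_prod_cancel:
  assumes "ideal M R" "M \<noteq> {\<zero>}" "ideal L R" "ideal N R" "M \<cdot> L = M \<cdot> N"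
  shows "L = N"
proof -
  define cancels where
    "cancels M \<longleftrightarrow> (\<forall>L N. ideal L R \<longrightarrow> ideal N R \<longrightarrow> M \<cdot> L = M \<cdot> N \<longrightarrow> L = N)" for M
  have "cancels M"
  proof (rule ccontr)
    assume "\<not> cancels M"
    let ?S = "{N. ideal N R \<and> N \<noteq> {\<zero>} \<and> \<not> cancels N}"
    \<comment> \<open>Noetherian induction in the form of a maximal counterexample
      \<open>I\<close>.\<close>
    obtain I where "I \<in> ?S" and max: "\<And>N. \<lbrakk> N \<in> ?S; I \<subseteq> N \<rbrakk> \<Longrightarrow> N = I"
      using maximal_ideal_exists[of ?S] \<open>\<not> cancels M\<close> assms(1,2) by blast
    then have I: "ideal I R" "I \<noteq> {\<zero>}" "\<not> cancels I" by auto
    interpret I: ideal I R by fact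
    have "I \<noteq> carrier R"
      using I(3) ideal_prod_one ideal_prod_commute[OF _ oneideal]
      unfolding cancels_def by metis
    then obtain P where P: "maximalideal P R" "I \<subseteq> P"
      using exists_maximalideal_superset I(1) by blast
    obtain a where "a \<in> I" "a \<noteq> \<zero>"
      using I(2) I.zero_closed by blast
    then have a: "a \<in> carrier R" "a \<noteq> \<zero>" "a \<in> I" using I.Icarr by auto
    have aR: "ideal (PIdl a) R" using a by (intro cgenideal_ideal)
    have "PIdl a \<noteq> {\<zero>}" using cgenideal_self[of a] a by auto
    moreover have "PIdl a \<subseteq> P"
      using a(3) I(1) P(2) cgenideal_minimal by blast
    ultimately obtain b where b: "b \<in> carrier R" "b \<notin> PIdl a" "\<And>y. y \<in> P \<Longrightarrow> y \<otimes> b \<in> PIdl a"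
      using exists_annihilated_by_maximalideal[OF P(1) aR] by blast
    define B where "B = {y \<in> carrier R. \<forall>x\<in>I. y \<otimes> x \<in> PIdl a}"
    have B: "ideal B R"
      unfolding B_def using aR I.a_subset by (rule colon_ideal)
    have IB: "ideal (I \<cdot> B) R" using I(1) B by (rule ideal_prod_is_ideal)
    \<comment> \<open>\<open>Q\<close> is \<open>(I \<cdot> B : a)\<close>; since
      \<open>I \<cdot> B\<close> lies in \<open>(a)\<close>, this is the quotient of
      \<open>I \<cdot> B\<close> by \<open>a\<close>.\<close>
    define Q where "Q = {y \<in> carrier R. \<forall>x\<in>{a}. y \<otimes> x \<in> I \<cdot> B}"
    have Q: "ideal Q R"
      unfolding Q_def using IB a by (intro colon_ideal) auto
    have aB: "a \<in> B"
      unfolding B_def using a I.Icarr by (auto simp: cgenideal_def m_comm)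
    have bB: "b \<in> B"
      unfolding B_def using b P(2) I.Icarr by (auto simp: m_comm)
    have "I \<subseteq> Q"
      unfolding Q_def using aB I.Icarr by (auto intro: ideal_prod.prod)
    have "Q \<noteq> I"
    proof
      assume "Q = I"
      have "\<exists>y\<in>I. b \<otimes> x = a \<otimes> y" if x: "x \<in> I" for x
      proof -
        have "b \<otimes> x \<in> PIdl a" using bB x by (simp add: B_def)
        then obtain y where y: "y \<in> carrier R" "b \<otimes> x = y \<otimes> a" by (auto simp: cgenideal_def)
        have "x \<otimes> b \<in> I \<cdot> B" using x bB by (rule ideal_prod.prod)
        \<comment> \<open>Here \<open>y\<close> is \<open>bx/a\<close>, so \<open>Q = I\<close>
          would make \<open>I\<close> stable under multiplication by \<open>b/a\<close>.\<close>
        then have "y \<in> Q" using y x b I.Icarr by (simp add: Q_def m_comm)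
        moreover have "b \<otimes> x = a \<otimes> y" using y a by (simp add: m_comm)
        ultimately show ?thesis using \<open>Q = I\<close> by blast
      qed
      then show False
        using stable_ideal_imp_divides[OF I(1,2) a(1,2) b(1)] b(2) by blast
    qed
    moreover have "Q \<noteq> {\<zero>}" using \<open>I \<subseteq> Q\<close> a by blast
    ultimately have "cancels Q" using max[of Q] Q \<open>I \<subseteq> Q\<close> by blast
    have IB_eq: "I \<cdot> B = (PIdl a) \<cdot> Q"
    proof
      show "(PIdl a) \<cdot> Q \<subseteq> I \<cdot> B"
      proof (rule ideal_prod_least[OF IB])
        fix i q assume "i \<in> PIdl a" and q: "q \<in> Q"
        then obtain r where r: "r \<in> carrier R" "i = r \<otimes> a" by (auto simp: cgenideal_def)
        have "r \<otimes> (q \<otimes> a) \<in> I \<cdot> B"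
          using q r ideal.I_l_closed[OF IB] by (simp add: Q_def)
        then show "i \<otimes> q \<in> I \<cdot> B"
          using r q a by (simp add: Q_def m_assoc m_comm[of q a])
      qed
      show "I \<cdot> B \<subseteq> (PIdl a) \<cdot> Q"
      proof (rule ideal_prod_least)
        show "ideal ((PIdl a) \<cdot> Q) R" using aR Q by (rule ideal_prod_is_ideal)
        fix i y assume iy: "i \<in> I" "y \<in> B"
        then have "y \<otimes> i \<in> PIdl a" "i \<otimes> y \<in> I \<cdot> B" by (auto simp: B_def intro: ideal_prod.prod)
        then obtain q where q: "q \<in> carrier R" "y \<otimes> i = q \<otimes> a" by (auto simp: cgenideal_def)
        have "i \<otimes> y = q \<otimes> a"
          using q iy I.Icarr ideal.Icarr[OF B] by (simp add: m_comm)
        then have "q \<in> Q"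
          using q \<open>i \<otimes> y \<in> I \<cdot> B\<close> by (simp add: Q_def)
        then have "a \<otimes> q \<in> (PIdl a) \<cdot> Q"
          using cgenideal_self[OF a(1)] by (rule ideal_prod.prod[rotated])
        then show "i \<otimes> y \<in> (PIdl a) \<cdot> Q"
          using q a \<open>i \<otimes> y = q \<otimes> a\<close> by (simp add: m_comm)
      qed
    qed
    have "cancels I"
      unfolding cancels_def
    proof (intro allI impI)
      fix L N assume L: "ideal L R" and N: "ideal N R" and eq: "I \<cdot> L = I \<cdot> N"
      \<comment> \<open>Multiplying \<open>I \<cdot> L = I \<cdot> N\<close> by \<open>B\<close>
        trades the factor \<open>I\<close> for \<open>(a)\<close> and \<open>Q\<close>, both of
        which cancel.\<close>
      have "(PIdl a) \<cdot> (Q \<cdot> Z) = B \<cdot> (I \<cdot> Z)" if "ideal Z R" for Z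
        using that IB_eq ideal_prod_assoc[OF aR Q] ideal_prod_assoc[OF B I(1)]
          ideal_prod_commute[OF I(1) B] by simp
      then have "(PIdl a) \<cdot> (Q \<cdot> L) = (PIdl a) \<cdot> (Q \<cdot> N)"
        using L N eq by simp
      then have "Q \<cdot> L = Q \<cdot> N"
        using ideal_prod_principal_cancel[OF a(1,2)] ideal_prod_is_ideal[OF Q] L N
        by (simp add: set_eq_subset)
      with \<open>cancels Q\<close> L N show "L = N" by (simp add: cancels_def)
    qed
    with I(3) show False by blast
  qed
  with assms(3-5) show ?thesis by (simp add: cancels_def)
qed

end

section \<open>Strict monotonicity of powers\<close>

lemma (in domain) ideal_prod_nonzero:
  assumes "ideal I R" "ideal J R" "I \<noteq> {\<zero>}" "J \<noteq> {\<zero>}"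
  shows "I \<cdot> J \<noteq> {\<zero>}"
proof -
  have "\<exists>k\<in>K. k \<noteq> \<zero>" if "ideal K R" "K \<noteq> {\<zero>}" for K
    using that additive_subgroup.zero_closed[OF ideal.axioms(1)[OF that(1)]] by blast
  then obtain i j where ij: "i \<in> I" "i \<noteq> \<zero>" "j \<in> J" "j \<noteq> \<zero>"
    using assms by meson
  then have "i \<otimes> j \<in> I \<cdot> J"
    by (intro ideal_prod.prod)
  moreover have "i \<otimes> j \<noteq> \<zero>"
    using ij integral ideal.Icarr[OF assms(1)] ideal.Icarr[OF assms(2)] by blast
  ultimately show ?thesis by blast
qed

theorem corollary8p2:
  fixes R :: "('a, 'b) ring_scheme" (structure)
    and I J :: "'a set"
    and n :: nat
  assumes "dedekind_domain R"
    and "ideal I R" and "ideal J R"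
    and "I \<noteq> {\<zero>}" and "J \<noteq> {\<zero>}"
    and "I \<subset> J"
    and "n \<ge> 1"
  shows "I [^]\<^bsub>ideals_set R\<^esub> n \<subset> J [^]\<^bsub>ideals_set R\<^esub> n"
proof -
  interpret dedekind_domain R by fact
  interpret S: comm_monoid "ideals_set R" by (rule ideals_set_is_comm_monoid)
  have S_simps: "carrier (ideals_set R) = {I. ideal I R}" "monoid.mult (ideals_set R) = ideal_prod R"
      "one (ideals_set R) = carrier R"
    by (simp_all add: ideals_set_def)
  let ?I = "\<lambda>k::nat. I [^]\<^bsub>ideals_set R\<^esub> k" and ?J = "\<lambda>k::nat. J [^]\<^bsub>ideals_set R\<^esub> k"
  have pow_Suc: "?I (Suc k) = ?I k \<cdot> I" "?J (Suc k) = ?J k \<cdot> J" for k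
    by (simp_all add: S_simps)
  have mono: "?I k \<subseteq> ?J k" for k
  proof (induction k)
    case (Suc k)
    then show ?case
      unfolding pow_Suc using assms(6) by (intro ideal_prod_mono) auto
  qed simp
  have J_ideal: "ideal (?J k) R" for k
    using S.nat_pow_closed[of J k] assms(3) by (simp add: S_simps)
  have J_nonzero: "?J k \<noteq> {\<zero>}" for k
  proof (induction k)
    case 0
    \<comment> \<open>The zeroth power is the whole ring.\<close>
    show ?case using one_closed one_not_zero by (metis S.nat_pow_0 S_simps(3) singletonD)
  next
    case (Suc k)
    then show ?case
      using ideal_prod_nonzero[OF J_ideal assms(3) _ assms(5)] by (simp only: pow_Suc)
  qed
  obtain k where n: "n = Suc k" using assms(7) by (cases n) auto
  have "?I n \<noteq> ?J n"
  proof
    assume "?I n = ?J n"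
    \<comment> \<open>The left side equals \<open>?I k \<cdot> I\<close> by the assumed equality,
      and \<open>?I k\<close> lies in \<open>?J k\<close>.\<close>
    then have "?J k \<cdot> J \<subseteq> ?J k \<cdot> I"
      using ideal_prod_mono[OF mono[of k] order_refl, of R I] by (simp only: n pow_Suc)
    moreover have "?J k \<cdot> I \<subseteq> ?J k \<cdot> J"
      using assms(6) by (intro ideal_prod_mono) auto
    ultimately have "I = J"
      using ideal_prod_cancel[OF J_ideal J_nonzero assms(2,3)] by blast
    with assms(6) show False by blast
  qed
  with mono[of n] show ?thesis by blast
qed

end
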